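(* Let $Q$ be a random variable with values in $[0,1]$ and $Q\stackrel{d}{=}1-Q$, and denote by $A(x):=2\,\mathbb{E}[\max\{x\,Q,(1-x)(1-Q)\}]$, $x\in[0,1]$, its associated Pickands dependence function in $\mathfrak{A}^X$. Assume furthermore that $A\in\mathfrak{A}^{\ast}$, i.e. that the bivariate extreme-value copula with Pickands dependence function $A$ arises, for arbitrarily large $d\ge2$, as a bivariate margin of some exchangeable $d$-variate extreme-value copula. (a) (Discrete case) If the support of $Q$ consists of finitely many values, then $$\mathbb{P}(Q=q)\le\frac{\mathbb{P}(Q=1/2)}{2\sqrt{q(1-q)}},\qquad q\in[0,1],$$ where for $q\in\{0,1\}$ the right-hand side is read as $+\infty$. (b) (Absolutely continuous case) If $Q$ is absolutely continuous with continuous density $f_Q$ (on $(0,1)$), then $$f_Q(q)\le\frac{f_Q(1/2)}{8\sqrt{q^3(1-q)^3}},\qquad q\in(0,1).$$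
   Context: A $d$-variate extreme-value copula is a distribution function $C:[0,1]^d\to[0,1]$ with one-dimensional margins uniform on $[0,1]$ satisfying $C(u_1^t,\ldots,u_d^t)=C(u_1,\ldots,u_d)^t$ for all $\vec{u}\in[0,1]^d$, $t>0$; it is exchangeable if it is invariant under permutations of its arguments. $\mathfrak{A}$ denotes the set of Pickands dependence functions: convex functions $A:[0,1]\to[1/2,1]$ with $\max\{x,1-x\}\le A(x)\le1$ for all $x$. Bivariate extreme-value copulas are exactly the functions $C_A(u_1,u_2)=(u_1u_2)^{A\left(\frac{\log u_1}{\log(u_1u_2)}\right)}$ (extended continuously to $[0,1]^2$) with $A\in\mathfrak{A}$. $\mathfrak{A}^X$ is the subset of those $A\in\mathfrak{A}$ with $A(x)=A(1-x)$ for all $x$ (equivalently, $C_A$ is exchangeable). Every $A\in\mathfrak{A}$ can be written as $A(x)=2\,\mathbb{E}[\max\{xQ,(1-x)(1-Q)\}]$ for a random variable $Q$ on $[0,1]$ with $\mathbb{E}[Q]=1/2$, whose law is unique, and $A\in\mathfrak{A}^X$ if and only if $Q\stackrel{d}{=}1-Q$. $\mathfrak{A}^{\ast}\subset\mathfrak{A}^X$ is the subset of those $A$ for which $C_A$ is a $2$-margin of an exchangeable $d$-variate extreme-value copula for arbitrarily large $d\ge2$. It is known (Mai, 2019) that $A\in\mathfrak{A}^{\ast}$ if and only if there are $b\in[0,1]$ and a probability measure $\lambda$ on the set $\mathfrak{F}_1$ of distribution functions of non-negative random variables with unit mean such that $A(x)=b+(1-b)\int_{\mathfrak{F}_1}A_F(x)\,\lambda(\mathrm{d}F)$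 for all $x\in[0,1]$, where $A_F(x):=\int_0^\infty 1-F\left(\frac{s}{x}\right)F\left(\frac{s}{1-x}\right)\mathrm{d}s$ (with $F(s/0):=1$). *)

theory Defs
  imports "HOL-Probability.Probability" "HOL-Combinatorics.Permutations"
begin

(* A d-variate function is modelled on sequences nat => real; only the arguments 0, ..., d-1
   matter: the equation for C below forces C to ignore all others on [0,1]^d. *)
definition copula :: "nat \<Rightarrow> ((nat \<Rightarrow> real) \<Rightarrow> real) \<Rightarrow> bool" where
  "copula d C \<longleftrightarrow>
    (\<exists>P. prob_space P \<and> sets P = sets (\<Pi>\<^sub>M i\<in>{..<d}. (borel :: real measure)) \<and>
      (\<forall>i<d. distr P borel (\<lambda>x. x i) = uniform_measure lborel {0..1}) \<and>
      (\<forall>u\<in>{..<d} \<rightarrow> {0..1}. C u = measure P {x \<in> space P. \<forall>i<d. x i \<le> u i}))"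

definition extreme_value_copula :: "nat \<Rightarrow> ((nat \<Rightarrow> real) \<Rightarrow> real) \<Rightarrow> bool" where
  "extreme_value_copula d C \<longleftrightarrow> copula d C \<and>
    (\<forall>u\<in>{..<d} \<rightarrow> {0..1}. \<forall>t>0. C (\<lambda>i. u i powr t) = C u powr t)"

definition exchangeable :: "nat \<Rightarrow> ((nat \<Rightarrow> real) \<Rightarrow> real) \<Rightarrow> bool" where
  "exchangeable d C \<longleftrightarrow>
    (\<forall>\<pi>. \<pi> permutes {..<d} \<longrightarrow> (\<forall>u\<in>{..<d} \<rightarrow> {0..1}. C (\<lambda>i. u (\<pi> i)) = C u))"

definition margin2 :: "((nat \<Rightarrow> real) \<Rightarrow> real) \<Rightarrow> nat \<Rightarrow> nat \<Rightarrow> real \<Rightarrow> real \<Rightarrow> real" where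
  "margin2 C i j u v = C ((\<lambda>_. 1)(i := u, j := v))"

definition pickands :: "(real \<Rightarrow> real) set" where
  "pickands = {A. convex_on {0..1} A \<and>
     (\<forall>x\<in>{0..1}. A x \<in> {1/2..1} \<and> max x (1 - x) \<le> A x \<and> A x \<le> 1)}"

definition pickands_sym :: "(real \<Rightarrow> real) set" where
  "pickands_sym = {A \<in> pickands. \<forall>x\<in>{0..1}. A x = A (1 - x)}"

(* For A in pickands this formula already gives the continuous extension to [0,1]^2: it is 0 if
   u = 0 or v = 0 (0 powr a = 0), and 1 at (1,1) (1 powr a = 1). *)
definition ev_copula2 :: "(real \<Rightarrow> real) \<Rightarrow> real \<Rightarrow> real \<Rightarrow> real" where
  "ev_copula2 A u v = (u * v) powr A (ln u / ln (u * v))"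

definition pickands_ext :: "(real \<Rightarrow> real) set" where
  "pickands_ext = {A \<in> pickands_sym. \<forall>N. \<exists>d\<ge>N. d \<ge> 2 \<and>
     (\<exists>C. extreme_value_copula d C \<and> exchangeable d C \<and>
        (\<exists>i<d. \<exists>j<d. i \<noteq> j \<and>
          (\<forall>u\<in>{0..1}. \<forall>v\<in>{0..1}. margin2 C i j u v = ev_copula2 A u v)))}"

definition pickands_of :: "'a measure \<Rightarrow> ('a \<Rightarrow> real) \<Rightarrow> real \<Rightarrow> real" where
  "pickands_of M Q x = 2 * (\<integral>\<omega>. max (x * Q \<omega>) ((1 - x) * (1 - Q \<omega>)) \<partial>M)"

definition law_support :: "'a measure \<Rightarrow> ('a \<Rightarrow> real) \<Rightarrow> real set" where
  "law_support M Q = {q. \<forall>U. open U \<and> q \<in> U \<longrightarrow> measure M {\<omega> \<in> space M. Q \<omega> \<in> U} > 0}"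

end

theory Submission
  imports Defs
begin

text \<open>
  With uniform margins written as \<open>exp (- s)\<close>, the copula is \<open>exp (- s - t + K s t)\<close> for the
  homogeneous kernel \<open>K s t = 2 E[min (s Q) (t (1 - Q))]\<close>. In an exchangeable vector of dimension \<open>d\<close>,
  the nonnegativity of \<open>E[(\<Sum>\<^sub>i Z\<^sub>i)\<^sup>2]\<close> for \<open>Z\<^sub>i = \<Sum>\<^sub>k c\<^sub>k 1{U\<^sub>i \<le> u\<^sub>k}\<close> gives, as \<open>d \<rightarrow> \<infinity>\<close>,
  that the copula is a positive semidefinite kernel. Rescaling by \<open>\<epsilon> \<rightarrow> 0\<close> transfers this to \<open>K\<close>.
  After normalisation \<open>K\<close> is a function of \<open>ln (s / t)\<close>, namely the convolution of \<open>exp (- \<bar>w\<bar> / 2)\<close> with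
  the law of \<open>w = ln ((1 - Q) / Q)\<close> weighted by \<open>2 sqrt (Q (1 - Q))\<close>. Taking second differences turns
  the exponential into a bump of small support, and a positive definite function is largest at 0, so the
  bump located at \<open>q\<close> carries at most the weighted mass of the bump located at \<open>1/2\<close>.
  Shrinking the bumps yields both bounds.
\<close>

section \<open>Exchangeability and positive semidefiniteness of the copula\<close>

lemma exists_permutes_pair:
  assumes "i \<in> S" "j \<in> S" "i \<noteq> j" "k \<in> S" "l \<in> S" "k \<noteq> l"
  obtains \<pi> where "\<pi> permutes S" "\<pi> i = k" "\<pi> j = l"
proof
  \<comment> \<open>\<open>?m\<close> is where \<open>j\<close> lies after \<open>i\<close> and
    \<open>k\<close> have been swapped; it differs from \<open>j\<close> only if
    \<open>j = k\<close>. Since neither \<open>?m\<close> nor \<open>l\<close> is \<open>k\<close>,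
    the second swap leaves the image of \<open>i\<close> alone.\<close>
  let ?m = "Transposition.transpose i k j"
  let ?\<pi> = "Transposition.transpose ?m l \<circ> Transposition.transpose i k"
  have m: "?m \<in> S" "?m \<noteq> k"
    using assms by (auto simp: Transposition.transpose_def)
  show "?\<pi> permutes S"
    using assms m by (intro permutes_compose permutes_swap_id) auto
  show "?\<pi> i = k"
    using assms m by simp
  show "?\<pi> j = l"
    by simp
qed

lemma exchangeable_margin2:
  assumes "exchangeable d C" "i < d" "j < d" "i \<noteq> j" "k < d" "l < d" "k \<noteq> l"
    and "u \<in> {0..1}" "v \<in> {0..1}"
  shows "margin2 C i j u v = margin2 C k l u v"
proof -
  obtain \<pi> where \<pi>: "\<pi> permutes {..<d}" "\<pi> i = k" "\<pi> j = l"
    using exists_permutes_pair[of i "{..<d}" j k l] assms by auto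
  let ?w = "(\<lambda>_. 1::real)(k := u, l := v)"
  \<comment> \<open>Injectivity guarantees that only \<open>i\<close> and \<open>j\<close> are sent
    to \<open>k\<close> and \<open>l\<close>, so every other argument stays 1.\<close>
  have "inj \<pi>"
    using \<pi>(1) by (rule permutes_inj)
  hence "(\<lambda>m. ?w (\<pi> m)) = (\<lambda>_. 1)(i := u, j := v)"
    using \<pi>(2,3) assms(4) by (auto simp: fun_eq_iff dest: injD)
  moreover have "?w \<in> {..<d} \<rightarrow> {0..1}"
    using assms by auto
  ultimately show ?thesis
    using assms(1) \<pi>(1) unfolding exchangeable_def margin2_def by metis
qed

text \<open>The second moment of the sum of the \<open>Z i\<close> has \<open>d * (d - 1)\<close>
  off-diagonal terms, each equal to the quadratic form in \<open>G\<close>. The \<open>d\<close>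
  diagonal terms involve one coordinate only and are not values of \<open>G\<close>; a crude bound
  suffices for them because their number is of lower order in \<open>d\<close>.\<close>

lemma copula_margin2_quadratic_form:
  assumes "copula d C"
    and G: "\<And>i j u v. i < d \<Longrightarrow> j < d \<Longrightarrow> i \<noteq> j \<Longrightarrow> u \<in> {0..1} \<Longrightarrow> v \<in> {0..1} \<Longrightarrow>
      margin2 C i j u v = G u v"
    and u: "\<And>k. k < n \<Longrightarrow> u k \<in> {0..1}"
  shows "0 \<le> real d * (real d - 1) * (\<Sum>k<n. \<Sum>l<n. c k * c l * G (u k) (u l)) +
    real d * (\<Sum>k<n. \<bar>c k\<bar>)\<^sup>2"
proof -
  obtain P where "prob_space P" and P: "sets P = sets (\<Pi>\<^sub>M i\<in>{..<d}. (borel :: real measure))"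
    and C: "\<And>u. u \<in> {..<d} \<rightarrow> {0..1} \<Longrightarrow> C u = measure P {x \<in> space P. \<forall>i<d. x i \<le> u i}"
    using assms(1) unfolding copula_def by blast
  interpret P: prob_space P by fact
  \<comment> \<open>Keeping the bound 1 on all other coordinates makes
    \<open>E i k \<inter> E j l\<close> literally the event whose probability is the value of
    \<open>C\<close> in \<open>margin2\<close>.\<close>
  define E where "E = (\<lambda>i k. {x \<in> space P. \<forall>m<d. x m \<le> ((\<lambda>_. 1)(i := u k)) m})"
  define Z where "Z = (\<lambda>i x. \<Sum>k<n. c k * indicator (E i k) x)"
  define S where "S = (\<Sum>k<n. \<Sum>l<n. c k * c l * G (u k) (u l))"
  define B where "B = (\<Sum>k<n. \<bar>c k\<bar>)"
  have [measurable_cong]: "sets P = sets (\<Pi>\<^sub>M i\<in>{..<d}. (borel :: real measure))"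
    by fact
  have comp[measurable]: "(\<lambda>x. x m) \<in> borel_measurable P" if "m < d" for m
    unfolding measurable_cong_sets[OF P refl] using that by (intro measurable_component_singleton) simp
  have E[measurable]: "E i k \<in> sets P" for i k
  proof -
    have "E i k = {x \<in> space P. \<forall>m\<in>{..<d}. x m \<le> ((\<lambda>_. 1)(i := u k)) m}"
      by (auto simp: E_def)
    also have "\<dots> \<in> sets P"
    proof (rule sets.sets_Collect_finite_All)
      show "{x \<in> space P. x m \<le> ((\<lambda>_. 1)(i := u k)) m} \<in> sets P" if "m \<in> {..<d}" for m
        using that by (intro borel_measurable_le comp borel_measurable_const) simp
    qed simp
    finally show ?thesis .
  qed
  have Z_mult: "Z i x * Z j x = (\<Sum>k<n. \<Sum>l<n. c k * c l * indicator (E i k \<inter> E j l) x)" for i j x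
    unfolding Z_def sum_product by (intro sum.cong refl) (auto simp: indicator_def)
  have int_indicator: "integrable P (\<lambda>x. c k * c l * indicator (E i k \<inter> E j l) x)" for i j k l
    by (intro integrable_mult_right integrable_real_indicator) (auto simp: P.emeasure_eq_measure)
  have int: "integrable P (\<lambda>x. Z i x * Z j x)" for i j
    unfolding Z_mult by (intro Bochner_Integration.integrable_sum int_indicator)
  have off: "P.expectation (\<lambda>x. Z i x * Z j x) = S" if ij: "i < d" "j < d" "i \<noteq> j" for i j
  proof -
    have "measure P (E i k \<inter> E j l) = G (u k) (u l)" if "k < n" "l < n" for k l
    proof -
      have "G (u k) (u l) = C ((\<lambda>_. 1)(i := u k, j := u l))"
        using G[OF ij u[OF that(1)] u[OF that(2)]] by (simp add: margin2_def)
      also have "\<dots> = measure P {x \<in> space P. \<forall>m<d. x m \<le> ((\<lambda>_. 1)(i := u k, j := u l)) m}"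
        using u[OF that(1)] u[OF that(2)] by (intro C) auto
      also have "{x \<in> space P. \<forall>m<d. x m \<le> ((\<lambda>_. 1)(i := u k, j := u l)) m} = E i k \<inter> E j l"
      proof -
        \<comment> \<open>The values of \<open>u\<close> are at most 1, so taking the minimum with
          the other bound, which is 1, changes nothing.\<close>
        have "((\<lambda>_. 1)(i := u k, j := u l)) m =
            min (((\<lambda>_. 1)(i := u k)) m) (((\<lambda>_. 1)(j := u l)) m)" for m
          using u[OF that(1)] u[OF that(2)] ij(3) by auto
        thus ?thesis
          unfolding E_def by (simp only: min.bounded_iff) blast
      qed
      finally show ?thesis by simp
    qed
    moreover have "P.expectation (\<lambda>x. Z i x * Z j x) =
        (\<Sum>k<n. P.expectation (\<lambda>x. \<Sum>l<n. c k * c l * indicator (E i k \<inter> E j l) x))"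
      unfolding Z_mult by (intro Bochner_Integration.integral_sum Bochner_Integration.integrable_sum int_indicator)
    moreover have "\<dots> = (\<Sum>k<n. \<Sum>l<n. P.expectation (\<lambda>x. c k * c l * indicator (E i k \<inter> E j l) x))"
      by (intro sum.cong refl Bochner_Integration.integral_sum int_indicator)
    ultimately show ?thesis
      by (simp add: S_def sets.Int)
  qed
  have Z_bound: "\<bar>Z i x\<bar> \<le> B" for i x
    unfolding Z_def B_def
    by (rule order_trans[OF sum_abs]) (auto intro!: sum_mono simp: abs_mult indicator_def)
  have diag: "P.expectation (\<lambda>x. Z i x * Z i x) \<le> B\<^sup>2" for i
  proof -
    have "P.expectation (\<lambda>x. Z i x * Z i x) \<le> P.expectation (\<lambda>x. B\<^sup>2)"
    proof (rule integral_mono)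
      show "Z i x * Z i x \<le> B\<^sup>2" for x
        using power_mono[OF Z_bound[of i x] abs_ge_zero, of 2] by (simp add: power2_eq_square)
    qed (simp_all add: int)
    thus ?thesis by (simp add: P.prob_space)
  qed
  have "0 \<le> P.expectation (\<lambda>x. (\<Sum>i<d. Z i x)\<^sup>2)"
    by simp
  also have "\<dots> = (\<Sum>i<d. \<Sum>j<d. P.expectation (\<lambda>x. Z i x * Z j x))"
    unfolding power2_eq_square sum_product
    by (simp add: Bochner_Integration.integral_sum int)
  also have "\<dots> \<le> (\<Sum>i<d. \<Sum>j<d. (if j = i then B\<^sup>2 else S))"
    using off diag by (intro sum_mono) auto
  also have "\<dots> = (\<Sum>i<d. \<Sum>j<d. (if j = i then B\<^sup>2 - S else 0) + S)"
    by (intro sum.cong refl) auto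
  also have "\<dots> = real d * (real d - 1) * S + real d * B\<^sup>2"
    by (simp add: sum.distrib algebra_simps)
  finally show ?thesis
    unfolding S_def B_def .
qed

text \<open>A negative value \<open>S\<close> of the form would make
  \<open>d * (d - 1) * S + d * B\<close> negative as soon as \<open>d - 1\<close> exceeds
  \<open>B / - S\<close>, and extendibility supplies such a \<open>d\<close>.\<close>

lemma pickands_ext_positive_semidefinite:
  assumes "A \<in> pickands_ext" and u: "\<And>k. k < n \<Longrightarrow> u k \<in> {0..1}"
  shows "0 \<le> (\<Sum>k<n. \<Sum>l<n. c k * c l * ev_copula2 A (u k) (u l))"
proof (rule ccontr)
  define S where "S = (\<Sum>k<n. \<Sum>l<n. c k * c l * ev_copula2 A (u k) (u l))"
  define B where "B = (\<Sum>k<n. \<bar>c k\<bar>)\<^sup>2"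
  assume "\<not> ?thesis"
  hence S: "S < 0" by (simp add: S_def)
  \<comment> \<open>The summand 1 compensates for the factor \<open>d - 1\<close> instead of
    \<open>d\<close>.\<close>
  obtain N :: nat where N: "B / - S + 1 < real N"
    using reals_Archimedean2 by blast
  from assms(1) obtain d C i j where d: "d \<ge> N" "d \<ge> 2" and C: "extreme_value_copula d C" "exchangeable d C"
    and ij: "i < d" "j < d" "i \<noteq> j"
    and m: "\<forall>u\<in>{0..1}. \<forall>v\<in>{0..1}. margin2 C i j u v = ev_copula2 A u v"
    unfolding pickands_ext_def by blast
  have "0 \<le> real d * (real d - 1) * S + real d * B"
    unfolding S_def B_def
  proof (rule copula_margin2_quadratic_form[OF _ _ u])
    show "copula d C"
      using C(1) by (simp add: extreme_value_copula_def)
    show "margin2 C i' j' u v = ev_copula2 A u v"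
      if "i' < d" "j' < d" "i' \<noteq> j'" "u \<in> {0..1}" "v \<in> {0..1}" for i' j' u v
      \<comment> \<open>Only one pair of coordinates is known to have the prescribed margin;
        exchangeability transfers it to all pairs.\<close>
      using exchangeable_margin2[OF C(2) that(1-3) ij that(4,5)] m that by auto
  qed
  hence "0 \<le> real d * ((real d - 1) * S + B)"
    by (simp add: algebra_simps)
  hence "0 \<le> (real d - 1) * S + B"
    using d by (simp add: zero_le_mult_iff)
  moreover have "B / - S < real d - 1"
    using N d by linarith
  hence "B < (real d - 1) * - S"
    using S by (subst (asm) pos_divide_less_eq) auto
  ultimately show False by simp
qed

section \<open>From exponentials of a kernel to the kernel itself\<close>

text \<open>As a function of \<epsilon> the assumed sum is nonnegative to the right of 0, and it
  vanishes at 0 because the weights sum to 0. Its derivative at 0, the quadratic form in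
  \<open>K\<close>, thus cannot be negative.\<close>

lemma conditionally_psd_of_exp_psd:
  fixes K :: "nat \<Rightarrow> nat \<Rightarrow> real"
  assumes "\<And>\<epsilon>. \<epsilon> > 0 \<Longrightarrow> 0 \<le> (\<Sum>k<n. \<Sum>l<n. c k * c l * exp (\<epsilon> * K k l))"
    and "(\<Sum>k<n. c k) = 0"
  shows "0 \<le> (\<Sum>k<n. \<Sum>l<n. c k * c l * K k l)"
proof (rule ccontr)
  define g where "g = (\<lambda>\<epsilon>. \<Sum>k<n. \<Sum>l<n. c k * c l * exp (\<epsilon> * K k l))"
  assume "\<not> ?thesis"
  hence neg: "(\<Sum>k<n. \<Sum>l<n. c k * c l * K k l) < 0"
    by simp
  have "((\<lambda>\<epsilon>. c k * c l * exp (\<epsilon> * K k l)) has_real_derivative c k * c l * K k l) (at 0)" for k l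
    by (auto intro!: derivative_eq_intros)
  hence "(g has_real_derivative (\<Sum>k<n. \<Sum>l<n. c k * c l * K k l)) (at 0)"
    unfolding g_def by (intro DERIV_sum)
  from DERIV_neg_dec_right[OF this neg] obtain \<delta> where "\<delta> > 0"
    and \<delta>: "\<forall>h>0. h < \<delta> \<longrightarrow> g (0 + h) < g 0"
    by blast
  have "g 0 = (\<Sum>k<n. c k) * (\<Sum>l<n. c l)"
    unfolding g_def sum_product by simp
  hence "g (\<delta> / 2) < 0"
    using \<delta>[rule_format, of "\<delta> / 2"] \<open>\<delta> > 0\<close> assms(2) by simp
  moreover have "0 \<le> g (\<delta> / 2)"
    unfolding g_def using \<open>\<delta> > 0\<close> by (intro assms(1)) simp
  ultimately show False
    by simp
qed

section \<open>The kernel and its second differences, the tent functions\<close>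

text \<open>For symmetric \<open>Q\<close> this is \<open>s + t\<close> minus the stable tail
  dependence function \<open>(s + t) * A (s / (s + t))\<close>.\<close>

definition min_kernel :: "'a measure \<Rightarrow> ('a \<Rightarrow> real) \<Rightarrow> real \<Rightarrow> real \<Rightarrow> real" where
  "min_kernel M Q s t = 2 * (\<integral>\<omega>. min (s * Q \<omega>) (t * (1 - Q \<omega>)) \<partial>M)"

text \<open>A triangular bump for \<open>r > 1\<close> and \<open>x > 0\<close>. On the scale
  \<open>ln (u / (1 - u))\<close> its support has centre \<open>ln x\<close> and radius
  \<open>ln r\<close>, so \<open>x\<close> sets the location and \<open>r\<close> the width.\<close>

definition tent :: "real \<Rightarrow> real \<Rightarrow> real \<Rightarrow> real" where
  "tent r x u = max 0 (min (r * u - x * (1 - u)) (r * x * (1 - u) - u))"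

text \<open>This links the bump to the kernel: the expectations of the minima on the right are
  kernel values. With \<open>a = u\<close> and \<open>b = x * (1 - u)\<close> it becomes an identity
  for two nonnegative numbers, and comparing \<open>a\<close> with \<open>b\<close> decides all but
  one of the comparisons.\<close>

lemma tent_eq_second_difference:
  assumes "r > 1" "x > 0" "0 \<le> u" "u \<le> 1"
  shows "tent r x u = (r + 1) * min u (x * (1 - u)) - min u (r * x * (1 - u)) - min (r * u) (x * (1 - u))"
proof -
  have "max 0 (min (r * a - b) (r * b - a)) = (r + 1) * min a b - min a (r * b) - min (r * a) b"
    if ab: "0 \<le> a" "0 \<le> b" for a b :: real
  proof (cases "a \<le> b")
    case True
    have "b \<le> r * b"
      using assms(1) ab mult_right_mono[of 1 r b] by simp
    hence "min a (r * b) = a" "min a b = a"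
      using True by simp_all
    moreover have "r * a \<le> r * b"
      using True assms(1) by simp
    hence "min (r * a - b) (r * b - a) = r * a - b"
      using True by simp
    ultimately show ?thesis
      by (simp add: distrib_right max_def min_def)
  next
    case False
    have "a \<le> r * a"
      using assms(1) ab mult_right_mono[of 1 r a] by simp
    hence "min (r * a) b = b" "min a b = b"
      using False by simp_all
    moreover have "r * b \<le> r * a"
      using False assms(1) by simp
    hence "min (r * a - b) (r * b - a) = r * b - a"
      using False by simp
    ultimately show ?thesis
      by (simp add: distrib_right max_def min_def)
  qed
  from this[of u "x * (1 - u)"] show ?thesis
    using assms by (simp add: tent_def mult.assoc)
qed

lemma borel_measurable_tent[measurable]: "tent r x \<in> borel_measurable borel"
  unfolding tent_def by measurable

lemma continuous_on_tent: "continuous_on S (tent r x)"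
  unfolding tent_def by (intro continuous_intros)

lemma tent_nonneg: "tent r x u \<ge> 0"
  by (simp add: tent_def)

text \<open>Displays the zeros of the two affine pieces, which are the ends of the support.\<close>

lemma tent_factored:
  assumes "r > 1" "x > 0"
  shows "tent r x u = max 0 (min ((r + x) * (u - x / (r + x))) ((1 + r * x) * (r * x / (1 + r * x) - u)))"
proof -
  have "r + x \<noteq> 0" "1 + r * x \<noteq> 0"
    using assms by (auto simp: add_pos_pos less_imp_neq[symmetric])
  hence "(r + x) * (u - x / (r + x)) = r * u - x * (1 - u)"
    "(1 + r * x) * (r * x / (1 + r * x) - u) = r * x * (1 - u) - u"
    by (simp_all add: right_diff_distrib) (simp_all add: algebra_simps)
  thus ?thesis
    by (simp add: tent_def)
qed

lemma tent_support:
  assumes "r > 1" "x > 0" "tent r x u \<noteq> 0"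
  shows "x / (r + x) < u" "u < r * x / (1 + r * x)"
proof -
  have "a > 0 \<and> b > 0" if "max 0 (min a b) \<noteq> 0" for a b :: real
    using that by (auto simp: max_def min_def split: if_splits)
  hence "(r + x) * (u - x / (r + x)) > 0" "(1 + r * x) * (r * x / (1 + r * x) - u) > 0"
    using assms(3) unfolding tent_factored[OF assms(1,2)] by blast+
  moreover have "r + x > 0" "1 + r * x > 0"
    using assms by (auto intro: add_pos_pos)
  ultimately show "x / (r + x) < u" "u < r * x / (1 + r * x)"
    by (simp_all only: zero_less_mult_iff) auto
qed

lemma tent_breakpoints:
  fixes r x :: real
  assumes "r > 1" "x > 0"
  shows "x / (r + x) < x / (1 + x)" "x / (1 + x) < r * x / (1 + r * x)"
proof -
  have "x < r * x"
    using assms mult_strict_right_mono[of 1 r x] by simp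
  thus "x / (r + x) < x / (1 + x)" "x / (1 + x) < r * x / (1 + r * x)"
    using assms by (auto simp: divide_simps add_pos_pos algebra_simps)
qed

text \<open>Both affine pieces take the same value at \<open>x / (1 + x)\<close>: they meet there,
  and the common value is the height of the peak.\<close>

lemma tent_slopes:
  fixes r x :: real
  assumes "r > 1" "x > 0"
  shows "(r + x) * (x / (1 + x) - x / (r + x)) = (r - 1) * (x / (1 + x))"
    "(1 + r * x) * (r * x / (1 + r * x) - x / (1 + x)) = (r - 1) * (x / (1 + x))"
proof -
  have "(1 + x) * (x / (1 + x)) = x" "(r + x) * (x / (r + x)) = x"
    "(1 + r * x) * (r * x / (1 + r * x)) = r * x"
    using assms by (simp_all add: add_pos_pos less_imp_neq[symmetric])
  \<comment> \<open>Describing the breakpoints by their defining equations keeps the algebra free of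
    division.\<close>
  moreover have "(r + x) * (p - a) = (r - 1) * p" if "(1 + x) * p = x" "(r + x) * a = x" for p a
    using that by (simp add: algebra_simps)
  moreover have "(1 + r * x) * (b - p) = (r - 1) * p" if "(1 + x) * p = x" "(1 + r * x) * b = r * x" for p b
  proof -
    have "(1 + r * x) * (b - p) = r * x - r * (x * p) - p"
      using that(2) by (simp add: algebra_simps)
    also have "x * p = x - p"
      using that(1) by (simp add: algebra_simps)
    finally show ?thesis
      by (simp add: algebra_simps)
  qed
  ultimately show "(r + x) * (x / (1 + x) - x / (r + x)) = (r - 1) * (x / (1 + x))"
    "(1 + r * x) * (r * x / (1 + r * x) - x / (1 + x)) = (r - 1) * (x / (1 + x))"
    by blast+
qed

lemma tent_left:
  assumes "r > 1" "x > 0" "u \<in> {x / (r + x)..x / (1 + x)}"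
  shows "tent r x u = (r + x) * (u - x / (r + x))"
proof -
  have "(1 + x) * u \<le> x"
    using assms by (simp add: le_divide_eq algebra_simps)
  \<comment> \<open>The first affine piece minus the second is
    \<open>(r + 1) * ((1 + x) * u - x)\<close>, so the first is the smaller one to the left of the
    peak.\<close>
  hence "(r + 1) * ((1 + x) * u) \<le> (r + 1) * x"
    using assms by (intro mult_left_mono) auto
  hence "r * u - x * (1 - u) \<le> r * x * (1 - u) - u"
    by (simp add: algebra_simps)
  moreover have "r * u - x * (1 - u) = (r + x) * (u - x / (r + x))"
    using assms by (simp add: right_diff_distrib) (simp add: algebra_simps)
  moreover have "(r + x) * (u - x / (r + x)) \<ge> 0"
    using assms by simp
  ultimately show ?thesis
    by (simp add: tent_def)
qed

lemma tent_right:
  assumes "r > 1" "x > 0" "u \<in> {x / (1 + x)..r * x / (1 + r * x)}"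
  shows "tent r x u = (1 + r * x) * (r * x / (1 + r * x) - u)"
proof -
  have pos: "1 + r * x > 0"
    using assms by (simp add: add_pos_pos)
  have "x \<le> (1 + x) * u"
    using assms by (simp add: divide_le_eq algebra_simps)
  hence "(r + 1) * x \<le> (r + 1) * ((1 + x) * u)"
    using assms by (intro mult_left_mono) auto
  hence "r * x * (1 - u) - u \<le> r * u - x * (1 - u)"
    by (simp add: algebra_simps)
  moreover have "r * x * (1 - u) - u = (1 + r * x) * (r * x / (1 + r * x) - u)"
    using pos by (simp add: right_diff_distrib) (simp add: algebra_simps)
  moreover have "(1 + r * x) * (r * x / (1 + r * x) - u) \<ge> 0"
    using assms pos by simp
  ultimately show ?thesis
    by (simp add: tent_def)
qed

lemma tent_peak:
  assumes "r > 1" "x > 0"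
  shows "tent r x (x / (1 + x)) = (r - 1) * (x / (1 + x))"
proof -
  have "tent r x (x / (1 + x)) = (r + x) * (x / (1 + x) - x / (r + x))"
    using tent_breakpoints[OF assms] by (intro tent_left assms) auto
  thus ?thesis
    using tent_slopes(1)[OF assms] by simp
qed

section \<open>Integrals of the tents and their limit as the width shrinks\<close>

lemma integrable_tent:
  assumes "r > 1" "x > 0"
  shows "integrable lborel (tent r x)"
proof -
  let ?S = "{x / (r + x)..r * x / (1 + r * x)}"
  have "integrable lborel (\<lambda>u. indicator ?S u *\<^sub>R tent r x u)"
    by (intro borel_integrable_compact continuous_on_tent) simp
  also have "(\<lambda>u. indicator ?S u *\<^sub>R tent r x u) = tent r x"
    using tent_support[OF assms] by (force simp: indicator_def fun_eq_iff)
  finally show ?thesis .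
qed

lemma has_integral_linear_rise:
  fixes c :: real
  assumes "a \<le> b"
  shows "((\<lambda>u. c * (u - a)) has_integral c * (b - a)\<^sup>2 / 2) {a..b}"
proof -
  have "((\<lambda>u. c * (u - a)\<^sup>2 / 2) has_real_derivative c * (u - a)) (at u within {a..b})" for u
    by (auto intro!: derivative_eq_intros)
  hence "((\<lambda>u. c * (u - a)) has_integral c * (b - a)\<^sup>2 / 2 - c * (a - a)\<^sup>2 / 2) {a..b}"
    using assms by (intro fundamental_theorem_of_calculus)
      (auto simp flip: has_real_derivative_iff_has_vector_derivative)
  thus ?thesis by simp
qed

lemma has_integral_linear_fall:
  fixes c :: real
  assumes "a \<le> b"
  shows "((\<lambda>u. c * (b - u)) has_integral c * (b - a)\<^sup>2 / 2) {a..b}"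
proof -
  have "((\<lambda>u. - (c * (b - u)\<^sup>2 / 2)) has_real_derivative c * (b - u)) (at u within {a..b})" for u
    by (rule derivative_eq_intros refl | simp)+ (simp add: field_simps)
  hence "((\<lambda>u. c * (b - u)) has_integral - (c * (b - b)\<^sup>2 / 2) - - (c * (b - a)\<^sup>2 / 2)) {a..b}"
    using assms by (intro fundamental_theorem_of_calculus)
      (auto simp flip: has_real_derivative_iff_has_vector_derivative)
  thus ?thesis by simp
qed

text \<open>The area of a triangle. Height and base each contain a factor \<open>r - 1\<close>,
  which explains the square isolated in front.\<close>

lemma integral_tent:
  assumes "r > 1" "x > 0"
  shows "integral\<^sup>L lborel (tent r x) =
    (r - 1)\<^sup>2 * (x / (1 + x) * x * (r + 1) / (2 * ((1 + r * x) * (r + x))))"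
proof -
  define a p b where "a = x / (r + x)" and "p = x / (1 + x)" and "b = r * x / (1 + r * x)"
  have ap: "a < p" "p < b"
    using tent_breakpoints[OF assms] by (auto simp: a_def p_def b_def)
  have "(tent r x has_integral (r + x) * (p - a)\<^sup>2 / 2) {a..p}"
    using has_integral_linear_rise[of a p "r + x"] ap tent_left[OF assms]
    by (subst has_integral_cong[where g = "\<lambda>u. (r + x) * (u - a)"]) (simp_all add: a_def p_def)
  moreover have "(tent r x has_integral (1 + r * x) * (b - p)\<^sup>2 / 2) {p..b}"
    using has_integral_linear_fall[of p b "1 + r * x"] ap tent_right[OF assms]
    by (subst has_integral_cong[where g = "\<lambda>u. (1 + r * x) * (b - u)"]) (simp_all add: b_def p_def)
  ultimately have "(tent r x has_integral (r + x) * (p - a)\<^sup>2 / 2 + (1 + r * x) * (b - p)\<^sup>2 / 2) {a..b}"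
    using ap by (intro has_integral_combine[of a p b]) auto
  hence "(tent r x has_integral (r + x) * (p - a)\<^sup>2 / 2 + (1 + r * x) * (b - p)\<^sup>2 / 2) UNIV"
  proof (rule has_integral_on_superset)
    show "tent r x u = 0" if "u \<notin> {a..b}" for u
      using tent_support[OF assms, of u] that unfolding a_def b_def
      by (meson atLeastAtMost_iff less_imp_le)
  qed simp
  hence "integral\<^sup>L lborel (tent r x) = (r + x) * (p - a)\<^sup>2 / 2 + (1 + r * x) * (b - p)\<^sup>2 / 2"
    using has_integral_integral_lborel[OF integrable_tent[OF assms]] has_integral_unique by blast
  \<comment> \<open>In each square one factor is traded for the common height
    \<open>(r - 1) * p\<close>, so that the two areas add up to half of height times base
    \<open>b - a\<close>.\<close>
  also have "(r + x) * (p - a) = (r - 1) * p" 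
    using tent_slopes(1)[OF assms] by (simp add: p_def a_def)
  hence "(r + x) * (p - a)\<^sup>2 = (r - 1) * p * (p - a)"
    by (simp add: power2_eq_square flip: mult.assoc)
  also have "(1 + r * x) * (b - p) = (r - 1) * p"
    using tent_slopes(2)[OF assms] by (simp add: p_def b_def)
  hence "(1 + r * x) * (b - p)\<^sup>2 = (r - 1) * p * (b - p)"
    by (simp add: power2_eq_square flip: mult.assoc)
  also have "(r - 1) * p * (p - a) / 2 + (r - 1) * p * (b - p) / 2 = (r - 1) * p * (b - a) / 2"
    by (simp add: field_simps)
  also have "b - a = (r - 1) * (x * (r + 1) / ((1 + r * x) * (r + x)))"
  proof -
    have "1 + r * x \<noteq> 0" "r + x \<noteq> 0"
      using assms by (auto simp: add_pos_pos less_imp_neq[symmetric])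
    thus ?thesis
      unfolding a_def b_def by (simp add: diff_frac_eq) (simp add: algebra_simps)
  qed
  finally show ?thesis
    by (simp add: p_def power2_eq_square mult_ac)
qed

text \<open>Divided by their integrals, the tents form an approximate identity at the peak
  \<open>x / (1 + x)\<close>. The remaining factor is the limit of the integral of the tent over
  \<open>(r - 1)\<^sup>2\<close>.\<close>

lemma tendsto_integral_tent:
  fixes f :: "real \<Rightarrow> real"
  assumes "x > 0" and f: "isCont f (x / (1 + x))"
    and int: "\<And>r. r > 1 \<Longrightarrow> integrable lborel (\<lambda>u. f u * tent r x u)"
  shows "((\<lambda>r. (\<integral>u. f u * tent r x u \<partial>lborel) / (r - 1)\<^sup>2) \<longlongrightarrow>
    f (x / (1 + x)) * (x / (1 + x) * x / (1 + x)\<^sup>2)) (at_right 1)"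
proof -
  define p where "p = x / (1 + x)"
  define I where "I = (\<lambda>r. \<integral>u. f u * tent r x u \<partial>lborel)"
  define T where "T = (\<lambda>r. integral\<^sup>L lborel (tent r x))"
  have T_eq: "T r = (r - 1)\<^sup>2 * (p * x * (r + 1) / (2 * ((1 + r * x) * (r + x))))" if "r > 1" for r
    using integral_tent[OF that assms(1)] by (simp add: T_def p_def)
  have T_pos: "T r > 0" if "r > 1" for r
    using that assms(1) unfolding T_eq[OF that] by (auto simp: p_def add_pos_pos)
  have r1: "eventually (\<lambda>r. r > 1) (at_right (1::real))"
    by (simp add: eventually_at_right_less)
  have "((\<lambda>r. I r / T r) \<longlongrightarrow> f p) (at_right 1)"
  proof (rule tendstoI)
    fix \<eta> :: real
    assume "\<eta> > 0"
    then obtain \<delta> where "\<delta> > 0" and \<delta>: "\<And>u. \<bar>u - p\<bar> < \<delta> \<Longrightarrow> \<bar>f u - f p\<bar> < \<eta> / 2"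
      using f[folded p_def] unfolding continuous_at_eps_delta dist_real_def by (metis half_gt_zero)
    \<comment> \<open>Both ends of the support tend to the peak, so eventually the tent lives where
      \<open>f\<close> is close to \<open>f p\<close>.\<close>
    have "((\<lambda>r. x / (r + x)) \<longlongrightarrow> x / (1 + x)) (at_right 1)"
      using assms(1) by (auto intro!: tendsto_eq_intros)
    hence "eventually (\<lambda>r. x / (r + x) > p - \<delta>) (at_right 1)"
      by (rule order_tendstoD) (use \<open>\<delta> > 0\<close> in \<open>simp add: p_def\<close>)
    moreover have "((\<lambda>r. r * x / (1 + r * x)) \<longlongrightarrow> x / (1 + x)) (at_right 1)"
      using assms(1) by (auto intro!: tendsto_eq_intros)
    hence "eventually (\<lambda>r. r * x / (1 + r * x) < p + \<delta>) (at_right 1)"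
      by (rule order_tendstoD) (use \<open>\<delta> > 0\<close> in \<open>simp add: p_def\<close>)
    ultimately show "eventually (\<lambda>r. dist (I r / T r) (f p) < \<eta>) (at_right 1)"
      using r1
    proof eventually_elim
      case (elim r)
      have bound: "\<bar>f u * tent r x u - f p * tent r x u\<bar> \<le> \<eta> / 2 * tent r x u" for u
      proof (cases "tent r x u = 0")
        case False
        hence "\<bar>u - p\<bar> < \<delta>"
          using tent_support[OF elim(3) assms(1) False] elim by (simp add: abs_less_iff)
        hence "\<bar>f u - f p\<bar> * tent r x u \<le> \<eta> / 2 * tent r x u"
          using \<delta> by (intro mult_right_mono tent_nonneg less_imp_le)
        thus ?thesis
          by (simp add: abs_mult tent_nonneg flip: left_diff_distrib)
      qed simp
      have "I r - f p * T r = (\<integral>u. f u * tent r x u - f p * tent r x u \<partial>lborel)"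
        using int[OF elim(3)] integrable_tent[OF elim(3) assms(1)] by (simp add: I_def T_def)
      also have "\<bar>\<dots>\<bar> \<le> (\<integral>u. \<bar>f u * tent r x u - f p * tent r x u\<bar> \<partial>lborel)"
        by (rule integral_abs_bound)
      also have "\<dots> \<le> (\<integral>u. \<eta> / 2 * tent r x u \<partial>lborel)"
        using int[OF elim(3)] integrable_tent[OF elim(3) assms(1)] bound by (intro integral_mono) auto
      also have "\<dots> = \<eta> / 2 * T r"
        by (simp add: T_def)
      finally have "\<bar>I r - f p * T r\<bar> / T r \<le> \<eta> / 2"
        using T_pos[OF elim(3)] by (simp add: divide_le_eq)
      also have "\<bar>I r - f p * T r\<bar> / T r = \<bar>I r / T r - f p\<bar>"
        using T_pos[OF elim(3)] by (simp add: abs_div_pos diff_divide_distrib)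
      finally show ?case
        using \<open>\<eta> > 0\<close> by (simp add: dist_real_def)
    qed
  qed
  moreover have "((\<lambda>r. p * x * (r + 1) / (2 * ((1 + r * x) * (r + x)))) \<longlongrightarrow> p * x / (1 + x)\<^sup>2) (at_right 1)"
  proof -
    have "1 + x \<noteq> 0"
      using assms(1) by simp
    hence "p * x * (1 + 1) / (2 * ((1 + 1 * x) * (1 + x))) = p * x / (1 + x)\<^sup>2"
      by (simp add: power2_eq_square)
    moreover have "((\<lambda>r. p * x * (r + 1) / (2 * ((1 + r * x) * (r + x)))) \<longlongrightarrow>
        p * x * (1 + 1) / (2 * ((1 + 1 * x) * (1 + x)))) (at_right 1)"
      using \<open>1 + x \<noteq> 0\<close> by (intro tendsto_intros) auto
    ultimately show ?thesis by (simp add: power2_eq_square)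
  qed
  ultimately have "((\<lambda>r. I r / T r * (p * x * (r + 1) / (2 * ((1 + r * x) * (r + x))))) \<longlongrightarrow>
      f p * (p * x / (1 + x)\<^sup>2)) (at_right 1)"
    by (rule tendsto_mult)
  moreover have "eventually (\<lambda>r. I r / T r * (p * x * (r + 1) / (2 * ((1 + r * x) * (r + x)))) =
      I r / (r - 1)\<^sup>2) (at_right 1)"
    using r1
  proof eventually_elim
    case (elim r)
    have "p * x * (r + 1) / (2 * ((1 + r * x) * (r + x))) = T r / (r - 1)\<^sup>2"
      using elim by (simp add: T_eq)
    thus ?case
      using T_pos[OF elim] by simp
  qed
  ultimately show ?thesis
    by (simp add: I_def p_def tendsto_cong)
qed

section \<open>The kernel of a symmetric random variable\<close>

locale symmetric_unit_rv = prob_space M for M :: "'a measure" +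
  fixes Q :: "'a \<Rightarrow> real"
  assumes measurable_Q[measurable]: "Q \<in> borel_measurable M"
    and Q_range: "\<omega> \<in> space M \<Longrightarrow> 0 \<le> Q \<omega> \<and> Q \<omega> \<le> 1"
    and Q_symmetric: "distr M borel Q = distr M borel (\<lambda>\<omega>. 1 - Q \<omega>)"
begin

lemma expectation_reflect:
  fixes g :: "real \<Rightarrow> real"
  assumes [measurable]: "g \<in> borel_measurable borel"
  shows "expectation (\<lambda>\<omega>. g (Q \<omega>)) = expectation (\<lambda>\<omega>. g (1 - Q \<omega>))"
proof -
  have "expectation (\<lambda>\<omega>. g (Q \<omega>)) = integral\<^sup>L (distr M borel Q) g"
    by (simp add: integral_distr)
  also have "\<dots> = expectation (\<lambda>\<omega>. g (1 - Q \<omega>))"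
    unfolding Q_symmetric by (simp add: integral_distr)
  finally show ?thesis .
qed

lemma integrable_continuous:
  fixes g :: "real \<Rightarrow> real"
  assumes "continuous_on UNIV g"
  shows "integrable M (\<lambda>\<omega>. g (Q \<omega>))"
proof -
  have [measurable]: "g \<in> borel_measurable borel"
    using assms by (rule borel_measurable_continuous_onI)
  have "bounded (g ` {0..1})"
    using assms by (intro compact_imp_bounded compact_continuous_image)
      (auto intro: continuous_on_subset)
  then obtain B where "\<forall>u\<in>{0..1}. norm (g u) \<le> B"
    unfolding bounded_iff by blast
  thus ?thesis
    using Q_range by (intro integrable_const_bound[where B = B] AE_I2) auto
qed

lemma integrable_min: "integrable M (\<lambda>\<omega>. min (s * Q \<omega>) (t * (1 - Q \<omega>)))"
  by (rule integrable_continuous) (intro continuous_intros)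

lemma expectation_Q: "expectation Q = 1 / 2"
proof -
  have "integrable M Q"
    using integrable_continuous[of "\<lambda>x. x"] by simp
  moreover have "expectation Q = expectation (\<lambda>\<omega>. 1 - Q \<omega>)"
    using expectation_reflect[of "\<lambda>x. x"] by simp
  ultimately show ?thesis
    by (simp add: prob_space)
qed

lemma min_kernel_commute: "min_kernel M Q s t = min_kernel M Q t s"
  unfolding min_kernel_def
  using expectation_reflect[of "\<lambda>u. min (s * u) (t * (1 - u))"] by (simp add: min.commute)

lemma min_kernel_scale:
  assumes "a \<ge> 0"
  shows "min_kernel M Q (a * s) (a * t) = a * min_kernel M Q s t"
proof -
  have "min (a * s * y) (a * t * z) = a * min (s * y) (t * z)" for y z
    using assms by (simp add: min_mult_distrib_left mult.assoc)
  thus ?thesis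
    by (simp add: min_kernel_def)
qed

lemma min_kernel_0:
  assumes "t \<ge> 0"
  shows "min_kernel M Q 0 t = 0" "min_kernel M Q t 0 = 0"
proof -
  have "expectation (\<lambda>\<omega>. min (0 * Q \<omega>) (t * (1 - Q \<omega>))) = expectation (\<lambda>\<omega>. 0)"
    using assms Q_range by (intro Bochner_Integration.integral_cong) (auto simp: min_def)
  thus "min_kernel M Q 0 t = 0"
    by (simp add: min_kernel_def)
  thus "min_kernel M Q t 0 = 0"
    by (simp add: min_kernel_commute)
qed

text \<open>A maximum is the sum minus the minimum, and \<open>Q\<close> has mean 1/2; hence
  \<open>(s + t) * A (s / (s + t))\<close> equals \<open>s + t\<close> minus the kernel.\<close>

lemma ev_copula2_pickands_of:
  assumes "s \<ge> 0" "t \<ge> 0"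
  shows "ev_copula2 (pickands_of M Q) (exp (- s)) (exp (- t)) =
    exp (- s) * exp (- t) * exp (min_kernel M Q s t)"
proof (cases "s + t = 0")
  \<comment> \<open>Here both arguments of the copula are 1, and the power is 1 whatever value the
    quotient 0 / 0 in the exponent has.\<close>
  case True
  hence "s = 0" "t = 0"
    using assms by auto
  thus ?thesis
    using min_kernel_0[of 0] by (simp add: ev_copula2_def)
next
  case False
  define x where "x = s / (s + t)"
  have st: "s + t > 0" "(s + t) * x = s" "(s + t) * (1 - x) = t"
    using False assms by (auto simp: x_def field_simps)
  have max: "(s + t) * max (x * y) ((1 - x) * z) = s * y + t * z - min (s * y) (t * z)" for y z
  proof -
    have "(s + t) * max (x * y) ((1 - x) * z) = max ((s + t) * x * y) ((s + t) * (1 - x) * z)"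
      using st(1) by (simp add: max_mult_distrib_left mult.assoc)
    thus ?thesis
      unfolding st by (simp add: max_def min_def)
  qed
  have "(s + t) * pickands_of M Q x =
      2 * expectation (\<lambda>\<omega>. (s + t) * max (x * Q \<omega>) ((1 - x) * (1 - Q \<omega>)))"
    by (simp add: pickands_of_def)
  also have "\<dots> = 2 * expectation (\<lambda>\<omega>. s * Q \<omega> + t * (1 - Q \<omega>)) - min_kernel M Q s t"
  proof -
    have "integrable M (\<lambda>\<omega>. s * Q \<omega> + t * (1 - Q \<omega>))"
      by (rule integrable_continuous) (intro continuous_intros)
    thus ?thesis
      unfolding max min_kernel_def using integrable_min[of s t]
      by (subst Bochner_Integration.integral_diff) auto
  qed
  also have "expectation (\<lambda>\<omega>. s * Q \<omega> + t * (1 - Q \<omega>)) = s / 2 + t / 2"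
    using integrable_continuous[of "\<lambda>u. u"] by (simp add: expectation_Q prob_space)
  finally have "(s + t) * pickands_of M Q x = s + t - min_kernel M Q s t"
    by simp
  moreover have "ln (exp (- s)) / ln (exp (- s) * exp (- t)) = x"
  proof -
    have "exp (- s) * exp (- t) = exp (- (s + t))"
      by (simp add: exp_add[symmetric])
    thus ?thesis
      unfolding x_def by (simp only: ln_exp minus_divide_divide)
  qed
  ultimately show ?thesis
    unfolding ev_copula2_def
    by (simp add: powr_def exp_add[symmetric] algebra_simps flip: exp_diff)
qed

lemma min_kernel_positive_semidefinite:
  fixes s c :: "nat \<Rightarrow> real"
  assumes ext: "pickands_of M Q \<in> pickands_ext" and s: "\<And>k. k < n \<Longrightarrow> s k \<ge> 0"
  shows "0 \<le> (\<Sum>k<n. \<Sum>l<n. c k * c l * min_kernel M Q (s k) (s l))"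
proof -
  \<comment> \<open>The kernel vanishes at the point 0, so adding that point makes the weights sum to 0.\<close>
  define s' where "s' = case_nat 0 s"
  define c' where "c' = case_nat (- (\<Sum>k<n. c k)) c"
  have s': "s' k \<ge> 0" if "k < Suc n" for k
    using that s by (cases k) (auto simp: s'_def)
  have "0 \<le> (\<Sum>k<Suc n. \<Sum>l<Suc n. c' k * c' l * min_kernel M Q (s' k) (s' l))"
  proof (rule conditionally_psd_of_exp_psd)
    show "(\<Sum>k<Suc n. c' k) = 0"
      by (subst sum.lessThan_Suc_shift) (simp add: c'_def)
    fix \<epsilon> :: real
    assume "\<epsilon> > 0"
    \<comment> \<open>The factor \<open>exp (\<epsilon> * s' k)\<close> cancels the product part
      \<open>exp (- (\<epsilon> * s' k))\<close> of the copula; by homogeneity of the kernel only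
      \<open>exp (\<epsilon> * K)\<close> is left.\<close>
    define e where "e = (\<lambda>k. c' k * exp (\<epsilon> * s' k))"
    have "0 \<le> (\<Sum>k<Suc n. \<Sum>l<Suc n. e k * e l *
        ev_copula2 (pickands_of M Q) (exp (- (\<epsilon> * s' k))) (exp (- (\<epsilon> * s' l))))"
      using s' \<open>\<epsilon> > 0\<close> by (intro pickands_ext_positive_semidefinite[OF ext]) auto
    also have "\<dots> = (\<Sum>k<Suc n. \<Sum>l<Suc n. c' k * c' l * exp (\<epsilon> * min_kernel M Q (s' k) (s' l)))"
    proof (intro sum.cong refl)
      fix k l assume "k \<in> {..<Suc n}" "l \<in> {..<Suc n}"
      hence "s' k \<ge> 0" "s' l \<ge> 0"
        using s' by auto
      hence "ev_copula2 (pickands_of M Q) (exp (- (\<epsilon> * s' k))) (exp (- (\<epsilon> * s' l))) =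
        exp (- (\<epsilon> * s' k)) * exp (- (\<epsilon> * s' l)) * exp (\<epsilon> * min_kernel M Q (s' k) (s' l))"
        using \<open>\<epsilon> > 0\<close> by (subst ev_copula2_pickands_of) (auto simp: min_kernel_scale)
      thus "e k * e l * ev_copula2 (pickands_of M Q) (exp (- (\<epsilon> * s' k))) (exp (- (\<epsilon> * s' l))) =
        c' k * c' l * exp (\<epsilon> * min_kernel M Q (s' k) (s' l))"
        by (simp add: e_def exp_minus field_simps)
    qed
    finally show "0 \<le> (\<Sum>k<Suc n. \<Sum>l<Suc n. c' k * c' l * exp (\<epsilon> * min_kernel M Q (s' k) (s' l)))" .
  qed
  also have "\<dots> = (\<Sum>k<n. \<Sum>l<n. c k * c l * min_kernel M Q (s k) (s l))"
    using s by (simp only: sum.lessThan_Suc_shift) (simp add: s'_def c'_def min_kernel_0)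
  finally show ?thesis .
qed

lemma expectation_tent:
  assumes "r > 1" "x > 0"
  shows "2 * expectation (\<lambda>\<omega>. tent r x (Q \<omega>)) =
    (r + 1) * min_kernel M Q 1 x - min_kernel M Q 1 (r * x) - min_kernel M Q r x"
proof -
  have "expectation (\<lambda>\<omega>. tent r x (Q \<omega>)) =
      expectation (\<lambda>\<omega>. (r + 1) * min (1 * Q \<omega>) (x * (1 - Q \<omega>)) -
        min (1 * Q \<omega>) (r * x * (1 - Q \<omega>)) - min (r * Q \<omega>) (x * (1 - Q \<omega>)))"
    using Q_range by (intro Bochner_Integration.integral_cong refl)
      (simp only: tent_eq_second_difference[OF assms] mult_1)
  thus ?thesis
    unfolding min_kernel_def
    using integrable_min[of 1 x] integrable_min[of 1 "r * x"] integrable_min[of r x]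
    by simp
qed

text \<open>The expectation divided by \<open>sqrt x\<close> is a positive definite function of
  \<open>ln x\<close>, and such a function is largest at 0. The root comes from normalising the
  kernel by \<open>sqrt (s * t)\<close>.\<close>

lemma expectation_tent_le:
  assumes "pickands_of M Q \<in> pickands_ext" "r > 1" "x > 0"
  shows "expectation (\<lambda>\<omega>. tent r x (Q \<omega>)) \<le> sqrt x * expectation (\<lambda>\<omega>. tent r 1 (Q \<omega>))"
proof -
  let ?K = "min_kernel M Q"
  define y where "y = sqrt x"
  have y: "y > 0" "x = y * y"
    using assms by (auto simp: y_def)
  \<comment> \<open>The weights \<open>1, - 1 / r\<close> produce the second difference, with peak at \<open>w = 0\<close>;
    subtracting their copy moved by the factor \<open>x\<close> compares the peaks at \<open>w = \<plusminus> ln x\<close> and \<open>w = 0\<close>.\<close>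
  let ?s = "\<lambda>k. [1, r, x, r * x] ! k"
  let ?c = "\<lambda>k. [1, - 1 / r, - 1 / y, 1 / (r * y)] ! k"
  have "0 \<le> (\<Sum>k<4. \<Sum>l<4. ?c k * ?c l * ?K (?s k) (?s l))"
    using assms by (intro min_kernel_positive_semidefinite) (auto simp: less_Suc_eq numeral_eq_Suc)
  also have "\<dots> = 2 * (1 + 1 / r) * ?K 1 1 - 4 / r * ?K 1 r -
      2 / y * ((1 + 1 / r) * ?K 1 x - ?K 1 (r * x) / r - ?K r x / r)"
  proof -
    \<comment> \<open>Homogeneity and symmetry reduce the sixteen kernel values to five. Dividing
      the moved weights by \<open>y\<close> offsets the factor \<open>x = y * y\<close> of their own
      quadratic form, so both diagonal blocks agree.\<close>
    have "?K r r = r * ?K 1 1" "?K x x = x * ?K 1 1" "?K (r * x) (r * x) = r * x * ?K 1 1"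
      "?K x (r * x) = x * ?K 1 r" "?K r (r * x) = r * ?K 1 x"
      using assms min_kernel_scale[of r 1 1] min_kernel_scale[of x 1 1]
        min_kernel_scale[of "r * x" 1 1] min_kernel_scale[of x 1 r] min_kernel_scale[of r 1 x]
      by (simp_all add: mult_ac)
    moreover have "?K r 1 = ?K 1 r" "?K x 1 = ?K 1 x" "?K (r * x) 1 = ?K 1 (r * x)"
      "?K x r = ?K r x" "?K (r * x) r = ?K r (r * x)" "?K (r * x) x = ?K x (r * x)"
      by (rule min_kernel_commute)+
    ultimately show ?thesis
      using y(1) assms(2) by (simp add: numeral_eq_Suc) (simp add: y(2) field_simps)
  qed
  finally have "2 / y * ((1 + 1 / r) * ?K 1 x - ?K 1 (r * x) / r - ?K r x / r) \<le>
      2 * (1 + 1 / r) * ?K 1 1 - 4 / r * ?K 1 r"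
    by simp
  hence "(r * y / 2) * (2 / y * ((1 + 1 / r) * ?K 1 x - ?K 1 (r * x) / r - ?K r x / r)) \<le>
      (r * y / 2) * (2 * (1 + 1 / r) * ?K 1 1 - 4 / r * ?K 1 r)"
    using y(1) assms(2) by (intro mult_left_mono) auto
  moreover have "(r * y / 2) * (2 / y * ((1 + 1 / r) * ?K 1 x - ?K 1 (r * x) / r - ?K r x / r)) =
      (r + 1) * ?K 1 x - ?K 1 (r * x) - ?K r x"
    using y(1) assms(2) by (simp add: field_simps)
  moreover have "(r * y / 2) * (2 * (1 + 1 / r) * ?K 1 1 - 4 / r * ?K 1 r) =
      y * ((r + 1) * ?K 1 1 - ?K 1 r - ?K 1 r)"
    using y(1) assms(2) by (simp add: field_simps)
  moreover have "2 * expectation (\<lambda>\<omega>. tent r 1 (Q \<omega>)) = (r + 1) * ?K 1 1 - ?K 1 r - ?K 1 r"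
    using expectation_tent[OF assms(2), of 1] min_kernel_commute[of 1 r] by simp
  ultimately have "2 * expectation (\<lambda>\<omega>. tent r x (Q \<omega>)) \<le>
      y * (2 * expectation (\<lambda>\<omega>. tent r 1 (Q \<omega>)))"
    using expectation_tent[OF assms(2,3)] by (simp only:)
  thus ?thesis
    by (simp add: y_def)
qed

section \<open>The bounds for atoms and for the density\<close>

text \<open>With \<open>r = 1 + h\<close>, the tent peaking at \<open>q\<close> is at least
  \<open>h * q\<close> on the event \<open>Q = q\<close>, while the tent at 1/2 is at most
  \<open>h / 2\<close> and lives within distance \<open>h\<close> of 1/2. The factor
  \<open>h\<close> cancels, and then \<open>h\<close> tends to 0.\<close>

lemma prob_eq_bound:
  assumes ext: "pickands_of M Q \<in> pickands_ext" and "0 < q" "q < 1"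
  shows "prob {\<omega> \<in> space M. Q \<omega> = q} \<le> prob {\<omega> \<in> space M. Q \<omega> = 1 / 2} / (2 * sqrt (q * (1 - q)))"
proof -
  define x where "x = q / (1 - q)"
  have x: "x > 0" "x / (1 + x) = q"
    using assms by (auto simp: x_def field_simps)
  let ?E = "{\<omega> \<in> space M. Q \<omega> = q}"
  define A where "A = (\<lambda>n. {\<omega> \<in> space M. \<bar>Q \<omega> - 1 / 2\<bar> \<le> inverse (real (Suc n))})"
  have [measurable]: "A n \<in> sets M" for n
    unfolding A_def by measurable
  have int: "integrable M (\<lambda>\<omega>. tent r y (Q \<omega>))" for r y
    by (intro integrable_continuous continuous_on_tent)
  have "q * prob ?E \<le> sqrt x / 2 * prob (A n)" for n
  proof -
    define h where "h = inverse (real (Suc n))"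
    define r where "r = 1 + h"
    have r: "h > 0" "r > 1"
      by (auto simp: h_def r_def)
    have "h * q * prob ?E = expectation (\<lambda>\<omega>. h * q * indicator ?E \<omega>)"
      by simp
    also have "\<dots> \<le> expectation (\<lambda>\<omega>. tent r x (Q \<omega>))"
    proof (intro integral_mono int)
      show "h * q * indicator ?E \<omega> \<le> tent r x (Q \<omega>)" for \<omega>
        using tent_peak[OF r(2) x(1)] by (auto simp: indicator_def x(2) r_def tent_nonneg)
    qed (auto simp: emeasure_eq_measure)
    also have "\<dots> \<le> sqrt x * expectation (\<lambda>\<omega>. tent r 1 (Q \<omega>))"
      by (intro expectation_tent_le ext r x)
    also have "expectation (\<lambda>\<omega>. tent r 1 (Q \<omega>)) \<le> expectation (\<lambda>\<omega>. h / 2 * indicator (A n) \<omega>)"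
    proof (intro integral_mono int)
      fix \<omega> assume "\<omega> \<in> space M"
      show "tent r 1 (Q \<omega>) \<le> h / 2 * indicator (A n) \<omega>"
      proof (cases "tent r 1 (Q \<omega>) = 0")
        case False
        have "\<bar>Q \<omega> - 1 / 2\<bar> \<le> h"
        proof -
          have "1 / 2 - h \<le> 1 / (r + 1)" "r / (1 + r) \<le> 1 / 2 + h"
            using r(1) by (auto simp: r_def field_simps)
          thus ?thesis
            using tent_support[OF r(2) zero_less_one False] by (auto simp: abs_le_iff)
        qed
        hence "\<omega> \<in> A n"
          using \<open>\<omega> \<in> space M\<close> by (simp add: A_def h_def)
        \<comment> \<open>For \<open>x = 1\<close> the two affine pieces sum to
          \<open>r - 1 = h\<close> at every point, so their minimum is at most
          \<open>h / 2\<close>.\<close>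
        moreover have "max 0 (min a b) \<le> (a + b) / 2" if "a + b \<ge> 0" for a b :: real
          using that by (auto simp: max_def min_def)
        from this[of "r * Q \<omega> - 1 * (1 - Q \<omega>)" "r * 1 * (1 - Q \<omega>) - Q \<omega>"]
        have "tent r 1 (Q \<omega>) \<le> h / 2"
          using r(1) by (simp add: tent_def r_def algebra_simps)
        ultimately show ?thesis
          by simp
      qed (use r(1) in \<open>simp add: indicator_def\<close>)
    qed (auto simp: emeasure_eq_measure)
    also have "\<dots> = h / 2 * prob (A n)"
      by simp
    finally have "h * (q * prob ?E) \<le> h * (sqrt x / 2 * prob (A n))"
      using x(1) by (simp add: mult_ac)
    thus ?thesis
      using r(1) by (rule mult_left_le_imp_le)
  qed
  \<comment> \<open>Continuity of the probability from above.\<close>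
  moreover have "(\<lambda>n. sqrt x / 2 * prob (A n)) \<longlonglongrightarrow> sqrt x / 2 * prob (\<Inter>n. A n)"
  proof (intro tendsto_mult tendsto_const finite_Lim_measure_decseq)
    show "decseq A"
      unfolding decseq_def
    proof (intro allI impI subsetI)
      fix m n :: nat and \<omega>
      assume "m \<le> n" and "\<omega> \<in> A n"
      moreover have "inverse (real (Suc n)) \<le> inverse (real (Suc m))"
        using \<open>m \<le> n\<close> by (intro le_imp_inverse_le) auto
      ultimately show "\<omega> \<in> A m"
        unfolding A_def mem_Collect_eq by linarith
    qed
  qed auto
  ultimately have "q * prob ?E \<le> sqrt x / 2 * prob (\<Inter>n. A n)"
    by (intro LIMSEQ_le_const) auto
  also have "(\<Inter>n. A n) = {\<omega> \<in> space M. Q \<omega> = 1 / 2}"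
  proof -
    have "y = 0" if "\<forall>n. \<bar>y\<bar> \<le> inverse (real (Suc n))" for y :: real
      using that reals_Archimedean[of "\<bar>y\<bar>"] by (force simp: not_less[symmetric])
    hence "(\<forall>n. \<bar>Q \<omega> - 1 / 2\<bar> \<le> inverse (real (Suc n))) \<longleftrightarrow> Q \<omega> = 1 / 2" for \<omega>
      by (metis abs_zero diff_self eq_iff_diff_eq_0 inverse_nonnegative_iff_nonnegative of_nat_0_le_iff)
    thus ?thesis
      unfolding A_def by blast
  qed
  finally have "prob ?E \<le> sqrt x / (2 * q) * prob {\<omega> \<in> space M. Q \<omega> = 1 / 2}"
    using \<open>0 < q\<close> by (simp add: field_simps)
  also have "sqrt x / (2 * q) = 1 / (2 * sqrt (q * (1 - q)))"
  proof -
    have "sqrt x * sqrt (q * (1 - q)) = sqrt (q * q)"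
      using assms by (simp add: x_def flip: real_sqrt_mult)
    thus ?thesis
      using assms by (simp add: field_simps)
  qed
  finally show ?thesis by simp
qed

text \<open>Dividing the tent inequality by \<open>(r - 1)\<^sup>2\<close> and letting
  \<open>r\<close> decrease to 1 turns each side into the density at the peak times an explicit
  factor.\<close>

lemma density_bound:
  assumes ext: "pickands_of M Q \<in> pickands_ext" and "0 < q" "q < 1"
    and f: "\<And>x. 0 \<le> f x" "distributed M lborel Q (\<lambda>x. ennreal (f x))" "continuous_on {0<..<1} f"
  shows "f q \<le> f (1 / 2) / (8 * sqrt (q ^ 3 * (1 - q) ^ 3))"
proof -
  define x where "x = q / (1 - q)"
  have x: "x > 0" "x / (1 + x) = q"
    using assms by (auto simp: x_def field_simps)
  have cont: "isCont f u" if "u \<in> {0<..<1}" for u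
    using f(3) that by (simp add: continuous_on_eq_continuous_at)
  have int: "integrable lborel (\<lambda>u. f u * tent r y u)" for r y
  proof -
    have "integrable lborel (\<lambda>u. f u * tent r y u) \<longleftrightarrow> integrable M (\<lambda>\<omega>. tent r y (Q \<omega>))"
      by (rule distributed_integrable[OF f(2)]) (simp_all add: f(1))
    thus ?thesis
      using integrable_continuous[OF continuous_on_tent] by blast
  qed
  have eq: "(\<integral>u. f u * tent r y u \<partial>lborel) = expectation (\<lambda>\<omega>. tent r y (Q \<omega>))" for r y
    by (rule distributed_integral[OF f(2)]) (simp_all add: f(1))
  have lim: "((\<lambda>r. expectation (\<lambda>\<omega>. tent r y (Q \<omega>)) / (r - 1)\<^sup>2) \<longlongrightarrow>
      f (y / (1 + y)) * (y / (1 + y) * y / (1 + y)\<^sup>2)) (at_right 1)" if "y > 0" for y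
  proof -
    have "isCont f (y / (1 + y))"
      using that by (intro cont) simp
    from tendsto_integral_tent[OF that this int] show ?thesis
      unfolding eq .
  qed
  \<comment> \<open>The constant 1/8 is \<open>x / (1 + x) * x / (1 + x)\<^sup>2\<close> at
    \<open>x = 1\<close>, where the peak is at 1/2.\<close>
  have "f q * (q * x / (1 + x)\<^sup>2) \<le> sqrt x * (f (1 / 2) * (1 / 8))"
  proof (rule tendsto_le)
    show "((\<lambda>r. expectation (\<lambda>\<omega>. tent r x (Q \<omega>)) / (r - 1)\<^sup>2) \<longlongrightarrow> f q * (q * x / (1 + x)\<^sup>2)) (at_right 1)"
      using lim[OF x(1)] by (simp add: x(2))
    show "((\<lambda>r. sqrt x * (expectation (\<lambda>\<omega>. tent r 1 (Q \<omega>)) / (r - 1)\<^sup>2)) \<longlongrightarrow>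
        sqrt x * (f (1 / 2) * (1 / 8))) (at_right 1)"
      using lim[of 1] by (intro tendsto_mult tendsto_const) (simp add: power2_eq_square)
    have "eventually (\<lambda>r. r > 1) (at_right (1::real))"
      by (simp add: eventually_at_right_less)
    thus "eventually (\<lambda>r. expectation (\<lambda>\<omega>. tent r x (Q \<omega>)) / (r - 1)\<^sup>2 \<le>
        sqrt x * (expectation (\<lambda>\<omega>. tent r 1 (Q \<omega>)) / (r - 1)\<^sup>2)) (at_right 1)"
    proof eventually_elim
      case (elim r)
      show ?case
        using divide_right_mono[OF expectation_tent_le[OF ext elim x(1)], of "(r - 1)\<^sup>2"] by simp
    qed
  qed simp
  also have "q * x / (1 + x)\<^sup>2 = q\<^sup>2 * (1 - q)"
  proof -
    have "1 + x = 1 / (1 - q)"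
      using assms by (simp add: x_def field_simps)
    thus ?thesis
      using assms by (simp add: x_def power2_eq_square)
  qed
  \<comment> \<open>Splitting off \<open>sqrt x\<close> lets it cancel against the same factor on
    the right.\<close>
  also have "q\<^sup>2 * (1 - q) = sqrt x * sqrt (q ^ 3 * (1 - q) ^ 3)"
  proof -
    have "x * (q ^ 3 * (1 - q) ^ 3) = (q\<^sup>2 * (1 - q))\<^sup>2"
      using assms by (simp add: x_def power2_eq_square power3_eq_cube)
    hence "sqrt x * sqrt (q ^ 3 * (1 - q) ^ 3) = sqrt ((q\<^sup>2 * (1 - q))\<^sup>2)"
      by (simp only: real_sqrt_mult[symmetric])
    also have "\<dots> = q\<^sup>2 * (1 - q)"
      using assms by (intro real_sqrt_unique) auto
    finally show ?thesis ..
  qed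
  finally have "sqrt x * (f q * sqrt (q ^ 3 * (1 - q) ^ 3)) \<le> sqrt x * (f (1 / 2) * (1 / 8))"
    by (simp add: mult_ac)
  hence "f q * sqrt (q ^ 3 * (1 - q) ^ 3) \<le> f (1 / 2) * (1 / 8)"
    using x(1) by simp
  thus ?thesis
    using assms by (simp add: field_simps)
qed

end

theorem lemma3p2:
  fixes M :: "'a measure" and Q :: "'a \<Rightarrow> real"
  assumes "prob_space M"
    and "Q \<in> borel_measurable M"
    and "\<forall>\<omega>\<in>space M. Q \<omega> \<in> {0..1}"
    and "distr M borel Q = distr M borel (\<lambda>\<omega>. 1 - Q \<omega>)"
    and "pickands_of M Q \<in> pickands_ext"
  shows "(finite (law_support M Q) \<longrightarrow>
      (\<forall>q\<in>{0..1}. ereal (measure M {\<omega> \<in> space M. Q \<omega> = q}) \<le>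
        (if q \<in> {0, 1} then \<infinity>
         else ereal (measure M {\<omega> \<in> space M. Q \<omega> = 1/2} / (2 * sqrt (q * (1 - q)))))))
    \<and> (\<forall>f :: real \<Rightarrow> real.
      (\<forall>x. 0 \<le> f x) \<and> distributed M lborel Q (\<lambda>x. ennreal (f x)) \<and> continuous_on {0<..<1} f \<longrightarrow>
      (\<forall>q\<in>{0<..<1}. f q \<le> f (1/2) / (8 * sqrt (q ^ 3 * (1 - q) ^ 3))))"
proof -
  interpret prob_space M
    by fact
  interpret symmetric_unit_rv M Q
    using assms(2-4) by unfold_locales auto
  show ?thesis
  proof (intro conjI impI allI ballI)
    fix q :: real
    assume "q \<in> {0..1}"
    thus "ereal (measure M {\<omega> \<in> space M. Q \<omega> = q}) \<le> (if q \<in> {0, 1} then \<infinity>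
        else ereal (measure M {\<omega> \<in> space M. Q \<omega> = 1/2} / (2 * sqrt (q * (1 - q)))))"
      using prob_eq_bound[OF assms(5), of q] by auto
  next
    fix f :: "real \<Rightarrow> real" and q :: real
    assume "(\<forall>x. 0 \<le> f x) \<and> distributed M lborel Q (\<lambda>x. ennreal (f x)) \<and> continuous_on {0<..<1} f"
      and "q \<in> {0<..<1}"
    thus "f q \<le> f (1/2) / (8 * sqrt (q ^ 3 * (1 - q) ^ 3))"
      using density_bound[OF assms(5), of q f] by simp
  qed
qed

end
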